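(* Let $a\in\mathbb{R}^{d\times(n+1)}$ with $f_i^L=a_{i0}<\cdots<a_{in}=f_i^U$ for each $i$, let $0=\tau(i,0)<\cdots<\tau(i,l_i)=n$ be integers for each $i\in\{1,\dots,d\}$, and let $\mathcal{H}=\{\prod_{i=1}^d[a_{i\tau(i,t_i-1)},a_{i\tau(i,t_i)}]\mid t\in\prod_{i=1}^d\{1,\dots,l_i\}\}$. Let $\theta=(\theta_1,\dots,\theta_\kappa):\mathbb{R}^d\to\mathbb{R}^\kappa$, and assume $\mathrm{conv}\bigl(\mathrm{hyp}(\theta\circ A)\bigr)=\mathrm{conv}\bigl(\mathrm{hyp}(\theta\circ A|_{\mathrm{vert}(\Lambda)})\bigr)$. Then an ideal MIP formulation of $\bigcup_{H\in\mathcal{H}}\mathrm{conv}\bigl(\mathrm{hyp}(\theta|_H)\bigr)$ (in the variables $(f,\mu)\in\mathbb{R}^d\times\mathbb{R}^\kappa$) is given by $$\Bigl\{(f,\mu,\lambda,\delta)\Bigm|(\lambda,\mu)\in\mathrm{conv}\bigl(\mathrm{hyp}(\theta\circ A)\bigr),\ f=A(\lambda),\ (\lambda_i,\delta_i)\in(\mathrm{LOG}_i),\ i=1,\dots,d\Bigr\}.$$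
   Context: $\Lambda=\prod_{i=1}^d\Lambda_i$, $\Lambda_i=\{\lambda_i=(\lambda_{i0},\dots,\lambda_{in})\ge0\mid\sum_{j=0}^n\lambda_{ij}=1\}$. $A:\Lambda\to\mathbb{R}^d$, $A(\lambda)=(A_1(\lambda_1),\dots,A_d(\lambda_d))$, $A_i(\lambda_i)=\sum_{j=0}^na_{ij}\lambda_{ij}$; $(\theta\circ A)(\lambda)=\theta(A(\lambda))$ for $\lambda\in\Lambda$. $(\mathrm{LOG}_i)$: fix a Gray code, i.e. distinct vectors $\eta^{(1)},\dots,\eta^{(n)}\in\{0,1\}^{\lceil\log_2n\rceil}$ such that adjacent vectors $\eta^{(t)},\eta^{(t+1)}$ differ in at most one component, and set $\eta^{(0)}=\eta^{(1)}$, $\eta^{(n+1)}=\eta^{(n)}$. Let $L_{ik}=\{j\in\{0,\dots,n\}\mid\eta^{(j)}_k=1\text{ or }\eta^{(j+1)}_k=1\}$ and $R_{ik}=\{j\in\{0,\dots,n\}\mid\eta^{(j)}_k=0\text{ or }\eta^{(j+1)}_k=0\}$. Then $(\lambda_i,\delta_i)\in(\mathrm{LOG}_i)$ means $\lambda_i\in\Lambda_i$, $\delta_i\in\{0,1\}^{\lceil\log_2n\rceil}$, and $\sum_{j\notin L_{ik}}\lambda_{ij}\le\delta_{ik}\le1-\sum_{j\notin R_{ik}}\lambda_{ij}$ for $k=1,\dots,\lceil\log_2n\rceil$. For vector-valued $g$ on $D$ and $Y\subseteq D$: $\mathrm{hyp}(g)=\{(x,\mu)\mid\mu\le g(x)\text{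 componentwise},\ x\in D\}$, $\mathrm{hyp}(g|_Y)=\{(x,\mu)\mid\mu\le g(x),\ x\in Y\}$; $\mathrm{conv}$ denotes the convex hull. For $S\subseteq\mathbb{R}^{n_1}$, $E=R\cap(\mathbb{R}^{n_1}\times\mathbb{R}^{n_2}\times\{0,1\}^{n_3})$, with $R$ in the space of $(x,y,\delta)$, is an MIP formulation of $S$ if $S=\mathrm{proj}_x(E)$; $R$ is its continuous relaxation (here $\delta_{ik}\in\{0,1\}$ replaced by $\delta_{ik}\in[0,1]$), and $E$ is ideal if $\mathrm{proj}_\delta(\mathrm{vert}(R))\subseteq\{0,1\}^{n_3}$, where $\mathrm{vert}$ denotes the set of extreme points.
   Formalization: (LOG_i) is formed with a Gray code of l_i words, one per cell [a_{iτ(i,t-1)},a_{iτ(i,t)}], shared by all intervals inside the cell, not n words; with n words the claim fails for coarser τ (θ=|x|, a=(-1,0,1), τ=(0,2)). For l_i=n it is unchanged. *)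

theory Defs
  imports "HOL-Analysis.Analysis" "HOL-Library.Function_Algebras"
begin

text \<open>
  The multipliers \<open>lam\<close> and the binaries \<open>\<delta>\<close> are families \<open>'d \<Rightarrow> nat \<Rightarrow> real\<close> (the
  number of components depends on numbers and may be zero), required to vanish outside
  their index range.  The pointwise vector space structure below makes the library's
  \<open>convex hull\<close> and \<open>extreme_point_of\<close> available for them.
\<close>

instantiation "fun" :: (type, real_vector) real_vector
begin

definition scaleR_fun :: "real \<Rightarrow> ('a \<Rightarrow> 'b) \<Rightarrow> 'a \<Rightarrow> 'b"
  where "scaleR_fun c f = (\<lambda>x. c *\<^sub>R f x)"

instance
  by standard (simp_all add: scaleR_fun_def fun_eq_iff scaleR_add_right scaleR_add_left)

end

definition vert :: "'a::real_vector set \<Rightarrow> 'a set"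
  where "vert S = {x. x extreme_point_of S}"

text \<open>The order on \<open>real ^ 'k\<close> is the componentwise one.\<close>

definition hyp :: "('a \<Rightarrow> (real ^ 'k)) \<Rightarrow> 'a set \<Rightarrow> ('a \<times> (real ^ 'k)) set"
  where "hyp g Y = {(x, \<mu>). x \<in> Y \<and> \<mu> \<le> g x}"


definition simplex_weights :: "nat \<Rightarrow> (nat \<Rightarrow> real) set"
  where "simplex_weights n =
    {w. (\<forall>j. 0 \<le> w j) \<and> (\<forall>j. n < j \<longrightarrow> w j = 0) \<and> (\<Sum>j=0..n. w j) = 1}"

definition Lam :: "nat \<Rightarrow> ('d \<Rightarrow> nat \<Rightarrow> real) set"
  where "Lam n = {lam. \<forall>i. lam i \<in> simplex_weights n}"

definition Amap :: "nat \<Rightarrow> ('d \<Rightarrow> nat \<Rightarrow> real) \<Rightarrow> ('d \<Rightarrow> nat \<Rightarrow> real) \<Rightarrow> real ^ 'd"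
  where "Amap n a lam = (\<chi> i. \<Sum>j=0..n. a i j * lam i j)"


definition grid_boxes ::
    "('d \<Rightarrow> nat \<Rightarrow> real) \<Rightarrow> ('d \<Rightarrow> nat) \<Rightarrow> ('d \<Rightarrow> nat \<Rightarrow> nat) \<Rightarrow> (real ^ 'd) set set"
  where "grid_boxes a l \<tau> =
    {cbox (\<chi> i. a i (\<tau> i (t i - 1))) (\<chi> i. a i (\<tau> i (t i))) | t. \<forall>i. t i \<in> {1..l i}}"


definition ceil_log2 :: "nat \<Rightarrow> nat"
  where "ceil_log2 m = nat \<lceil>log 2 (real m)\<rceil>"

definition unit_cube :: "nat \<Rightarrow> (nat \<Rightarrow> real) set"
  where "unit_cube K = {v. (\<forall>k\<in>{1..K}. 0 \<le> v k \<and> v k \<le> 1) \<and> (\<forall>k. k \<notin> {1..K} \<longrightarrow> v k = 0)}"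

definition binary_vectors :: "nat \<Rightarrow> (nat \<Rightarrow> real) set"
  where "binary_vectors K = {v. (\<forall>k\<in>{1..K}. v k \<in> {0, 1}) \<and> (\<forall>k. k \<notin> {1..K} \<longrightarrow> v k = 0)}"

definition gray_code :: "nat \<Rightarrow> (nat \<Rightarrow> nat \<Rightarrow> real) \<Rightarrow> bool"
  where "gray_code m \<eta> \<longleftrightarrow>
    (\<forall>t\<in>{1..m}. \<eta> t \<in> binary_vectors (ceil_log2 m)) \<and>
    inj_on \<eta> {1..m} \<and>
    (\<forall>t\<in>{1..<m}. card {k \<in> {1..ceil_log2 m}. \<eta> t k \<noteq> \<eta> (Suc t) k} \<le> 1)"

text \<open>
  \<open>interval_code n \<tau> \<eta> j\<close> is the code word carried by the \<open>j\<close>-th interval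
  \<open>[a (j - 1), a j]\<close>, namely the word \<open>\<eta> t\<close> of the cell \<open>[a (\<tau> (t - 1)), a (\<tau> t)]\<close>
  containing it.  The clamping of \<open>j\<close> to \<open>{1..n}\<close> is the convention that the words
  with index \<open>0\<close> and \<open>n + 1\<close> repeat those with index \<open>1\<close> and \<open>n\<close>.  For the finest
  partition, \<open>\<tau> t = t\<close>, the word with index \<open>j \<in> {1..n}\<close> is just \<open>\<eta> j\<close>; for a coarser
  one, all intervals inside a cell share its word, since otherwise the binaries would
  select single intervals rather than cells: with \<open>n = 2\<close>, \<open>a = (-1, 0, 1)\<close>,
  \<open>\<theta> x = \<bar>x\<bar>\<close> and the single cell \<open>[-1, 1]\<close>, two distinct words would exclude
  \<open>(f, \<mu>) = (0, 1)\<close>, which lies in the convex hull of the hypograph over that cell.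
\<close>

definition interval_code ::
    "nat \<Rightarrow> (nat \<Rightarrow> nat) \<Rightarrow> (nat \<Rightarrow> nat \<Rightarrow> real) \<Rightarrow> nat \<Rightarrow> nat \<Rightarrow> real"
  where "interval_code n \<tau> \<eta> j = \<eta> (LEAST t. max 1 (min n j) \<le> \<tau> t)"

lemma interval_code_finest:
  assumes "1 \<le> n" and "\<And>t. t \<le> n \<Longrightarrow> \<tau> t = t"
  shows "j \<in> {1..n} \<Longrightarrow> interval_code n \<tau> \<eta> j = \<eta> j"
    and "interval_code n \<tau> \<eta> 0 = \<eta> 1"
    and "interval_code n \<tau> \<eta> (n + 1) = \<eta> n"
proof -
  have *: "(LEAST t. m \<le> \<tau> t) = m" if "m \<le> n" for m
  proof (rule Least_equality)
    show "m \<le> \<tau> m" using assms(2) that by simp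
    show "m \<le> t" if "m \<le> \<tau> t" for t
      using that assms(2)[of t] \<open>m \<le> n\<close> by (cases "t \<le> n") auto
  qed
  show "j \<in> {1..n} \<Longrightarrow> interval_code n \<tau> \<eta> j = \<eta> j"
    and "interval_code n \<tau> \<eta> 0 = \<eta> 1"
    and "interval_code n \<tau> \<eta> (n + 1) = \<eta> n"
    using assms(1) by (auto simp: interval_code_def * max_def min_def)
qed

text \<open>Below, \<open>\<zeta>\<close> is the family of code words with indices \<open>0, \<dots>, n + 1\<close>.\<close>

definition Lset :: "nat \<Rightarrow> (nat \<Rightarrow> nat \<Rightarrow> real) \<Rightarrow> nat \<Rightarrow> nat set"
  where "Lset n \<zeta> k = {j \<in> {0..n}. \<zeta> j k = 1 \<or> \<zeta> (j + 1) k = 1}"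

definition Rset :: "nat \<Rightarrow> (nat \<Rightarrow> nat \<Rightarrow> real) \<Rightarrow> nat \<Rightarrow> nat set"
  where "Rset n \<zeta> k = {j \<in> {0..n}. \<zeta> j k = 0 \<or> \<zeta> (j + 1) k = 0}"

definition LOG_relaxed ::
    "nat \<Rightarrow> nat \<Rightarrow> (nat \<Rightarrow> nat \<Rightarrow> real) \<Rightarrow> ((nat \<Rightarrow> real) \<times> (nat \<Rightarrow> real)) set"
  where "LOG_relaxed n K \<zeta> =
    {(w, v). w \<in> simplex_weights n \<and> v \<in> unit_cube K \<and>
       (\<forall>k\<in>{1..K}. (\<Sum>j\<in>{0..n} - Lset n \<zeta> k. w j) \<le> v k \<and>
                   v k \<le> 1 - (\<Sum>j\<in>{0..n} - Rset n \<zeta> k. w j))}"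

definition LOG ::
    "nat \<Rightarrow> nat \<Rightarrow> (nat \<Rightarrow> nat \<Rightarrow> real) \<Rightarrow> ((nat \<Rightarrow> real) \<times> (nat \<Rightarrow> real)) set"
  where "LOG n K \<zeta> =
    {(w, v). w \<in> simplex_weights n \<and> v \<in> binary_vectors K \<and>
       (\<forall>k\<in>{1..K}. (\<Sum>j\<in>{0..n} - Lset n \<zeta> k. w j) \<le> v k \<and>
                   v k \<le> 1 - (\<Sum>j\<in>{0..n} - Rset n \<zeta> k. w j))}"


text \<open>
  \<open>E\<close> is an ideal formulation of \<open>S\<close> with continuous relaxation \<open>R\<close>, in variables
  \<open>(x, y, \<delta>)\<close>; the integer variables are \<open>\<delta> i k\<close> with \<open>k \<in> {1..K i}\<close>.
\<close>

definition ideal_MIP_formulation ::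
    "('d \<Rightarrow> nat) \<Rightarrow> ('x::real_vector \<times> 'y::real_vector \<times> ('d \<Rightarrow> nat \<Rightarrow> real)) set \<Rightarrow>
     ('x \<times> 'y \<times> ('d \<Rightarrow> nat \<Rightarrow> real)) set \<Rightarrow> 'x set \<Rightarrow> bool"
  where "ideal_MIP_formulation K R E S \<longleftrightarrow>
    E = R \<inter> (UNIV \<times> UNIV \<times> {\<delta>. \<forall>i. \<delta> i \<in> binary_vectors (K i)}) \<and>
    S = (\<lambda>(x, y, \<delta>). x) ` E \<and>
    (\<lambda>(x, y, \<delta>). \<delta>) ` vert R \<subseteq> {\<delta>. \<forall>i. \<delta> i \<in> binary_vectors (K i)}"

end

theory Submission
  imports Defs
begin

text \<open>
  Binary \<open>\<delta>\<^sub>i\<close> in \<open>LOG\<close> select a cell: since consecutive code words differ in at most one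
  component, the nodes compatible with \<open>\<delta>\<^sub>i\<close> are exactly those of the cell whose word is the
  complement of \<open>\<delta>\<^sub>i\<close>.  These nodes span a face of \<open>\<Lambda>\<close>, so the points of
  \<open>conv (hyp (\<theta> \<circ> A))\<close> above that face are convex combinations of points of the hypograph above
  it, which gives the projection.

  For ideality, each \<open>\<delta>\<^sub>i\<^sub>k\<close> of an extreme point of the relaxation equals its lower or its upper
  bound, and both are partial sums of \<open>\<lambda>\<^sub>i\<close>.  So \<open>\<delta> = D \<lambda>\<close> for a linear \<open>D\<close> whose values are
  feasible on all of \<open>\<Lambda>\<close>; hence \<open>(\<lambda>, \<mu>)\<close> is an extreme point of
  \<open>conv (hyp (\<theta> \<circ> A)) = conv (hyp (\<theta> \<circ> A|vert \<Lambda>))\<close>, \<open>\<lambda>\<close> is a vertex of \<open>\<Lambda>\<close>, and \<open>D\<close> is binary at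
  vertices.
\<close>

section \<open>Partial sums of simplex weights, linearity of \<open>Amap\<close>, and vertices of
  \<open>Lam n\<close>\<close>

lemma scaleR_fun_apply [simp]: "(c *\<^sub>R f) x = c *\<^sub>R f x"
  by (simp add: scaleR_fun_def)

lemma simplex_weightsD:
  assumes "w \<in> simplex_weights n"
  shows "0 \<le> w j" and "n < j \<Longrightarrow> w j = 0" and "(\<Sum>j=0..n. w j) = 1"
  using assms by (auto simp: simplex_weights_def)

lemma simplex_weights_sum_le:
  assumes "w \<in> simplex_weights n" and "S \<subseteq> T" and "T \<subseteq> {0..n}"
  shows "sum w S \<le> sum w T"
  using simplex_weightsD(1)[OF assms(1)] assms(2,3)
  by (intro sum_mono2) (auto intro: finite_subset)

lemma simplex_weights_sum_bounds:
  assumes "w \<in> simplex_weights n" and "S \<subseteq> {0..n}"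
  shows "0 \<le> sum w S" and "sum w S \<le> 1"
  using simplex_weights_sum_le[OF assms(1), of "{}" S] simplex_weights_sum_le[OF assms(1), of S "{0..n}"]
    simplex_weightsD(3)[OF assms(1)] assms(2) by auto

lemma simplex_weights_sum_complement:
  assumes "w \<in> simplex_weights n" and "S \<subseteq> {0..n}"
  shows "1 - (\<Sum>j\<in>{0..n} - S. w j) = (\<Sum>j\<in>S. w j)"
  using simplex_weightsD(3)[OF assms(1)] sum.subset_diff[OF assms(2), of w] by simp

lemma convex_simplex_weights: "convex (simplex_weights n)"
  unfolding convex_def simplex_weights_def
  by (auto simp: sum.distrib simp flip: sum_distrib_left)

lemma convex_Lam: "convex (Lam n)"
  using convex_simplex_weights[of n] unfolding convex_def Lam_def by auto

lemma Amap_add: "Amap n a (x + y) = Amap n a x + Amap n a y"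
  by (simp add: Amap_def vec_eq_iff algebra_simps sum.distrib)

lemma Amap_scaleR: "Amap n a (c *\<^sub>R x) = c *\<^sub>R Amap n a x"
  by (simp add: Amap_def vec_eq_iff sum_distrib_left mult.left_commute)

text \<open>A weight \<open>c\<close> strictly between 0 and 1 splits row \<open>i\<close> into the
  unit vector \<open>e\<close> at \<open>j\<close>, taken with factor \<open>c\<close>, and the
  renormalised remainder \<open>w'\<close>, taken with factor \<open>1 - c\<close>. Keeping all
  other rows fixed gives a proper segment in \<open>Lam n\<close> through
  \<open>lam\<close>.\<close>

lemma vert_Lam_binary:
  assumes "lam \<in> vert (Lam n)"
  shows "lam i j \<in> {0, 1}"
proof (rule ccontr)
  assume neq: "lam i j \<notin> {0, 1}"
  define c where "c = lam i j"
  define e where "e = (\<lambda>m. if m = j then 1 else (0::real))"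
  have lam: "lam \<in> Lam n"
    using assms by (simp add: vert_def extreme_point_of_def)
  then have w: "lam i \<in> simplex_weights n" by (simp add: Lam_def)
  have j: "j \<le> n"
    using simplex_weightsD(2)[OF w, of j] neq by (cases "j \<le> n") auto
  have "sum (lam i) {j} \<le> 1"
    using simplex_weights_sum_bounds[OF w, of "{j}"] j by simp
  then have c: "0 < c" "c < 1"
    using neq simplex_weightsD(1)[OF w, of j] by (auto simp: c_def)
  define w' where "w' = (\<lambda>m. (lam i m - c * e m) / (1 - c))"
  have e_simplex: "e \<in> simplex_weights n"
    using j by (auto simp: simplex_weights_def e_def)
  have "(\<Sum>m=0..n. lam i m - c * e m) = 1 - c"
    using simplex_weightsD(3)[OF w] simplex_weightsD(3)[OF e_simplex]
    by (simp add: sum_subtractf flip: sum_distrib_left)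
  then have w': "w' \<in> simplex_weights n"
    using c simplex_weightsD(1,2)[OF w] j
    by (auto simp: simplex_weights_def w'_def e_def c_def simp flip: sum_divide_distrib)
  have in_Lam: "lam(i := e) \<in> Lam n" "lam(i := w') \<in> Lam n"
    using lam e_simplex w' by (auto simp: Lam_def)
  have "(1 - c) * w' m = lam i m - c * e m" for m
    using c by (simp add: w'_def)
  then have "lam = (1 - c) *\<^sub>R lam(i := w') + c *\<^sub>R lam(i := e)"
    by (auto simp: fun_eq_iff algebra_simps)
  moreover have "lam(i := w') \<noteq> lam(i := e)"
  proof
    assume "lam(i := w') = lam(i := e)"
    then have "w' j = e j" by (metis fun_upd_same)
    then show False by (simp add: w'_def e_def c_def)
  qed
  ultimately have "lam \<in> open_segment (lam(i := w')) (lam(i := e))"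
    using c by (auto simp only: in_segment)
  then show False
    using assms in_Lam by (auto simp: vert_def extreme_point_of_def)
qed

text \<open>Such a sum is an integer, and partial sums of simplex weights stay in [0,1].\<close>

lemma simplex_weights_binary_sum:
  assumes "w \<in> simplex_weights n" and "\<And>j. w j \<in> {0, 1}" and "S \<subseteq> {0..n}"
  shows "sum w S \<in> {0, 1}"
proof -
  have "sum w S \<in> \<int>"
  proof (intro Ints_sum)
    show "w j \<in> \<int>" for j using assms(2)[of j] by auto
  qed
  then obtain z :: int where z: "sum w S = of_int z" by (auto elim: Ints_cases)
  then have "0 \<le> z" "z \<le> 1"
    using simplex_weights_sum_bounds[OF assms(1,3)] by auto
  then have "z = 0 \<or> z = 1" by auto
  then show ?thesis using z by auto
qed

section \<open>Code words and cells\<close>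

text \<open>Only indices below \<open>t\<close> compete with it for the least element, so strict
  monotonicity on \<open>{0..l}\<close> decides the question although \<open>LEAST\<close> ranges
  over all naturals.\<close>

lemma interval_code_eq:
  assumes "strict_mono_on {0..l} \<tau>" and "t \<in> {1..l}"
    and "\<tau> (t - 1) < max 1 (min n j)" and "max 1 (min n j) \<le> \<tau> t"
  shows "interval_code n \<tau> \<eta> j = \<eta> t"
proof -
  have "(LEAST t. max 1 (min n j) \<le> \<tau> t) = t"
  proof (rule Least_equality)
    fix s assume s: "max 1 (min n j) \<le> \<tau> s"
    show "t \<le> s"
    proof (rule ccontr)
      assume "\<not> t \<le> s"
      then have "\<tau> s \<le> \<tau> (t - 1)"
        using assms(2) by (intro strict_mono_on_leD[OF assms(1)]) auto
      then show False using s assms(3) by linarith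
    qed
  qed (fact assms(4))
  then show ?thesis by (simp add: interval_code_def)
qed

lemma cell_of_interval:
  fixes \<tau> :: "nat \<Rightarrow> nat"
  assumes "\<tau> 0 = 0" and "1 \<le> m" and "m \<le> \<tau> l"
  obtains t where "t \<in> {1..l}" and "\<tau> (t - 1) < m" and "m \<le> \<tau> t"
proof -
  define t where "t = (LEAST t. m \<le> \<tau> t)"
  have 1: "m \<le> \<tau> t" and 2: "t \<le> l"
    unfolding t_def using assms(3) by (auto intro: LeastI Least_le)
  have 3: "t \<noteq> 0" using 1 assms(1,2) by (metis not_one_le_zero le_trans)
  then have "\<not> m \<le> \<tau> (t - 1)"
    unfolding t_def by (intro not_less_Least) auto
  then show thesis using 1 2 3 by (intro that[of t]) auto
qed

text \<open>Clamping puts every index \<open>j\<close> into \<open>{1..n}\<close>, so even the words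
  at 0 and \<open>n + 1\<close> come from a genuine cell.\<close>

lemma interval_code_obtain:
  assumes "1 \<le> n" and "\<tau> 0 = 0" and "\<tau> l = n" and "strict_mono_on {0..l} \<tau>"
  obtains t where "t \<in> {1..l}" and "interval_code n \<tau> \<eta> j = \<eta> t"
    and "\<tau> (t - 1) < max 1 (min n j)" and "max 1 (min n j) \<le> \<tau> t"
proof -
  obtain t where "t \<in> {1..l}" "\<tau> (t - 1) < max 1 (min n j)" "max 1 (min n j) \<le> \<tau> t"
    using cell_of_interval[of \<tau> "max 1 (min n j)" l] assms(1-3) by auto
  then show thesis using interval_code_eq[OF assms(4)] that by blast
qed

lemma interval_code_binary:
  assumes "1 \<le> n" and "\<tau> 0 = 0" and "\<tau> l = n" and "strict_mono_on {0..l} \<tau>"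
    and "gray_code l \<eta>"
  shows "interval_code n \<tau> \<eta> j \<in> binary_vectors (ceil_log2 l)"
  using interval_code_obtain[OF assms(1-4), of \<eta> j] assms(5)
  unfolding gray_code_def by metis

text \<open>The next interval either stays in the same cell, where the words agree, or enters the
  following cell, where the Gray property of \<open>\<eta>\<close> applies.\<close>

lemma interval_code_adjacent:
  assumes "1 \<le> n" and "\<tau> 0 = 0" and "\<tau> l = n" and "strict_mono_on {0..l} \<tau>"
    and "gray_code l \<eta>"
  shows "card {k \<in> {1..ceil_log2 l}. interval_code n \<tau> \<eta> j k \<noteq> interval_code n \<tau> \<eta> (j + 1) k} \<le> 1"
proof -
  obtain t where t: "t \<in> {1..l}" "interval_code n \<tau> \<eta> j = \<eta> t"
    "\<tau> (t - 1) < max 1 (min n j)" "max 1 (min n j) \<le> \<tau> t"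
    by (rule interval_code_obtain[OF assms(1-4), of \<eta> j])
  show ?thesis
  proof (cases "max 1 (min n (j + 1)) \<le> \<tau> t")
    case True
    then have "interval_code n \<tau> \<eta> (j + 1) = \<eta> t"
      using t by (intro interval_code_eq[OF assms(4)]) auto
    then show ?thesis using t by simp
  next
    case False
    \<comment> \<open>The clamped index grows by at most 1, so it passes the right end of the cell
      by exactly one interval.\<close>
    then have eq: "max 1 (min n (j + 1)) = \<tau> t + 1" using t(4) by linarith
    then have "\<tau> t < \<tau> l" using assms(1,3) by linarith
    then have "t < l" using t(1) by (cases "t = l") auto
    then have "\<tau> t < \<tau> (t + 1)"
      using strict_mono_onD[OF assms(4), of t "t + 1"] by auto
    then have "interval_code n \<tau> \<eta> (j + 1) = \<eta> (t + 1)"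
      using eq \<open>t < l\<close> by (intro interval_code_eq[OF assms(4)]) auto
    then show ?thesis
      using assms(5) t(1,2) \<open>t < l\<close> by (auto simp: gray_code_def)
  qed
qed

text \<open>A binary value makes one of the two bounds tight, which kills all weights outside
  \<open>Lset\<close> or \<open>Rset\<close>. What survives are nodes touching an interval with one
  fixed word, and a word determines its cell.\<close>

lemma LOG_imp_cell:
  assumes "1 \<le> n" and "\<tau> 0 = 0" and "\<tau> l = n" and "strict_mono_on {0..l} \<tau>"
    and "gray_code l \<eta>"
    and "(w, v) \<in> LOG n (ceil_log2 l) (interval_code n \<tau> \<eta>)"
  obtains t where "t \<in> {1..l}" and "\<And>j. w j \<noteq> 0 \<Longrightarrow> j \<in> {\<tau> (t - 1)..\<tau> t}"
proof -
  define K where "K = ceil_log2 l"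
  define \<zeta> where "\<zeta> = interval_code n \<tau> \<eta>"
  \<comment> \<open>The complement of \<open>v\<close> is the selected word: \<open>v k = 0\<close>
    forces the support into \<open>Lset\<close>, that is, to words with entry 1. The default 0
    matches the code words outside \<open>{1..K}\<close>, so that whole functions can be
    compared.\<close>
  define b where "b = (\<lambda>k. if k \<in> {1..K} then 1 - v k else 0)"
  have w: "w \<in> simplex_weights n" and v: "v \<in> binary_vectors K"
    and bounds: "\<And>k. k \<in> {1..K} \<Longrightarrow>
        (\<Sum>j\<in>{0..n} - Lset n \<zeta> k. w j) \<le> v k \<and> v k \<le> 1 - (\<Sum>j\<in>{0..n} - Rset n \<zeta> k. w j)"
    using assms(6) by (auto simp: LOG_def K_def \<zeta>_def)
  have zero: "w j = 0" if "j \<in> S" "S \<subseteq> {0..n}" "sum w S \<le> 0" for j S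
    using that simplex_weightsD(1)[OF w] finite_subset[OF that(2)]
    by (metis finite_atLeastAtMost order_antisym sum_nonneg sum_nonneg_eq_0_iff)
  have word: "\<exists>t\<in>{1..l}. \<eta> t = b \<and> j \<in> {\<tau> (t - 1)..\<tau> t}" if wj: "w j \<noteq> 0" for j
  proof -
    have j: "j \<le> n" using simplex_weightsD(2)[OF w, of j] wj by (cases "j \<le> n") auto
    have match: "\<zeta> j k = b k \<or> \<zeta> (j + 1) k = b k" if k: "k \<in> {1..K}" for k
    proof -
      have "v k = 0 \<or> v k = 1" using v k by (auto simp: binary_vectors_def)
      then show ?thesis
      proof
        assume "v k = 0"
        then have "j \<in> Lset n \<zeta> k"
          using bounds[OF k] zero[of j "{0..n} - Lset n \<zeta> k"] wj j by auto
        then show ?thesis using k \<open>v k = 0\<close> by (auto simp: Lset_def b_def)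
      next
        assume "v k = 1"
        then have "j \<in> Rset n \<zeta> k"
          using bounds[OF k] zero[of j "{0..n} - Rset n \<zeta> k"] wj j by auto
        then show ?thesis using k \<open>v k = 1\<close> by (auto simp: Rset_def b_def)
      qed
    qed
    have bin: "\<zeta> m \<in> binary_vectors K" for m
      unfolding \<zeta>_def K_def by (rule interval_code_binary[OF assms(1-5)])
    have card: "card {k \<in> {1..K}. \<zeta> j k \<noteq> \<zeta> (j + 1) k} \<le> 1"
      unfolding \<zeta>_def K_def by (rule interval_code_adjacent[OF assms(1-5)])
    have outside: "\<zeta> m k = b k" if "k \<notin> {1..K}" for m k
      using bin[of m] that by (auto simp: binary_vectors_def b_def)
    \<comment> \<open>Each component of \<open>b\<close> is matched by one of the two words. If the
      first failed at \<open>k\<close> and the second at \<open>k'\<close>, then \<open>k\<close>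
      and \<open>k'\<close> would be two distinct places where adjacent words differ.\<close>
    have "\<zeta> j = b \<or> \<zeta> (j + 1) = b"
    proof (rule ccontr)
      assume "\<not> ?thesis"
      then obtain k k' where k: "\<zeta> j k \<noteq> b k" "\<zeta> (j + 1) k' \<noteq> b k'" by (auto simp: fun_eq_iff)
      then have "k \<in> {1..K}" "k' \<in> {1..K}" using outside by blast+
      with k match[of k] match[of k'] have "k \<noteq> k'"
        and "{k, k'} \<subseteq> {k \<in> {1..K}. \<zeta> j k \<noteq> \<zeta> (j + 1) k}" by auto
      then have "card {k, k'} \<le> card {k \<in> {1..K}. \<zeta> j k \<noteq> \<zeta> (j + 1) k}"
        by (intro card_mono) simp
      with card \<open>k \<noteq> k'\<close> show False by simp
    qed
    then obtain m where m: "m = j \<or> m = j + 1" "\<zeta> m = b" by auto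
    obtain t where t: "t \<in> {1..l}" "interval_code n \<tau> \<eta> m = \<eta> t"
      "\<tau> (t - 1) < max 1 (min n m)" "max 1 (min n m) \<le> \<tau> t"
      by (rule interval_code_obtain[OF assms(1-4), of \<eta> m])
    \<comment> \<open>Node \<open>j\<close> is an endpoint of the clamped interval \<open>m\<close>,
      which lies in cell \<open>t\<close>; for \<open>j = 0\<close> and \<open>j = n\<close> the
      clamping keeps this true.\<close>
    have "j \<in> {\<tau> (t - 1)..\<tau> t}"
      using m(1) t(3,4) j assms(1) by auto
    then show ?thesis using t m(2) by (auto simp: \<zeta>_def)
  qed
  have "\<exists>j. w j \<noteq> 0"
    using simplex_weightsD(3)[OF w] by (metis sum.neutral zero_neq_one)
  then obtain t where t: "t \<in> {1..l}" "\<eta> t = b" using word by blast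
  \<comment> \<open>All supporting nodes lead to the word \<open>b\<close>, so injectivity places
    them in one common cell.\<close>
  have inj: "inj_on \<eta> {1..l}" using assms(5) by (simp add: gray_code_def)
  have "j \<in> {\<tau> (t - 1)..\<tau> t}" if "w j \<noteq> 0" for j
    using word[OF that] t inj by (metis inj_onD)
  then show thesis using t(1) that by blast
qed

text \<open>The witness is the complement of the word of the cell. Where that word is 1 the support
  lies in \<open>Lset\<close> and the lower bound is 0; where it is 0 the support lies in
  \<open>Rset\<close> and the upper bound is 1.\<close>

lemma cell_imp_LOG:
  assumes "\<tau> l = n" and "strict_mono_on {0..l} \<tau>"
    and "gray_code l \<eta>" and "t \<in> {1..l}" and w: "w \<in> simplex_weights n"
    and supp: "\<And>j. w j \<noteq> 0 \<Longrightarrow> j \<in> {\<tau> (t - 1)..\<tau> t}"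
  shows "(w, \<lambda>k. if k \<in> {1..ceil_log2 l} then 1 - \<eta> t k else 0)
           \<in> LOG n (ceil_log2 l) (interval_code n \<tau> \<eta>)"
proof -
  define \<zeta> where "\<zeta> = interval_code n \<tau> \<eta>"
  have \<eta>: "\<eta> t \<in> binary_vectors (ceil_log2 l)"
    using assms(3,4) by (simp add: gray_code_def)
  have lt: "\<tau> (t - 1) < \<tau> t"
    using assms(4) by (intro strict_mono_onD[OF assms(2)]) auto
  have le: "\<tau> t \<le> n"
    using assms(1,4) strict_mono_on_leD[OF assms(2), of t l] by auto
  \<comment> \<open>At the left end of the cell, the interval inside the cell is the one to the
    right, with index \<open>j + 1\<close>; any other node has its left interval, with index
    \<open>j\<close>, inside the cell.\<close>
  have code: "\<zeta> j = \<eta> t \<or> \<zeta> (j + 1) = \<eta> t" if "w j \<noteq> 0" for j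
  proof (cases "j = \<tau> (t - 1)")
    case True
    then have "\<zeta> (j + 1) = \<eta> t"
      unfolding \<zeta>_def using lt le by (intro interval_code_eq[OF assms(2,4)]) auto
    then show ?thesis ..
  next
    case False
    then have "\<zeta> j = \<eta> t"
      unfolding \<zeta>_def using supp[OF that] le by (intro interval_code_eq[OF assms(2,4)]) auto
    then show ?thesis ..
  qed
  have L: "(\<Sum>j\<in>{0..n} - Lset n \<zeta> k. w j) = 0" if "\<eta> t k = 1" for k
    by (rule sum.neutral) (use code that in \<open>auto simp: Lset_def\<close>, metis)
  have R: "(\<Sum>j\<in>{0..n} - Rset n \<zeta> k. w j) = 0" if "\<eta> t k = 0" for k
    by (rule sum.neutral) (use code that in \<open>auto simp: Rset_def\<close>, metis)
  have bounds: "(\<Sum>j\<in>{0..n} - Lset n \<zeta> k. w j) \<le> 1 - \<eta> t k \<and>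
      1 - \<eta> t k \<le> 1 - (\<Sum>j\<in>{0..n} - Rset n \<zeta> k. w j)" if "k \<in> {1..ceil_log2 l}" for k
  proof -
    have "\<eta> t k = 0 \<or> \<eta> t k = 1" using \<eta> that by (auto simp: binary_vectors_def)
    then show ?thesis
      using L[of k] R[of k] simplex_weights_sum_bounds[OF w, of "{0..n} - Lset n \<zeta> k"]
        simplex_weights_sum_bounds[OF w, of "{0..n} - Rset n \<zeta> k"] by auto
  qed
  show ?thesis
    using w \<eta> bounds by (auto simp: LOG_def binary_vectors_def \<zeta>_def)
qed

section \<open>Cells of the grid\<close>

lemma weighted_mean_bounds:
  fixes c :: "nat \<Rightarrow> real"
  assumes "w \<in> simplex_weights n" and "\<And>j. w j \<noteq> 0 \<Longrightarrow> x \<le> c j \<and> c j \<le> y"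
  shows "x \<le> (\<Sum>j=0..n. c j * w j)" and "(\<Sum>j=0..n. c j * w j) \<le> y"
proof -
  have "x * w j \<le> c j * w j" "c j * w j \<le> y * w j" for j
    using assms(2)[of j] simplex_weightsD(1)[OF assms(1), of j]
    by (cases "w j = 0"; auto intro: mult_right_mono)+
  then have "(\<Sum>j=0..n. x * w j) \<le> (\<Sum>j=0..n. c j * w j)"
    "(\<Sum>j=0..n. c j * w j) \<le> (\<Sum>j=0..n. y * w j)"
    by (auto intro: sum_mono)
  then show "x \<le> (\<Sum>j=0..n. c j * w j)" "(\<Sum>j=0..n. c j * w j) \<le> y"
    using simplex_weightsD(3)[OF assms(1)] by (auto simp flip: sum_distrib_left)
qed

text \<open>Linear interpolation between the nodes \<open>p\<close> and \<open>q\<close>, with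
  \<open>u\<close> the relative position of \<open>x\<close>. Writing \<open>w\<close> as a sum of
  two one-point functions lets the sums split.\<close>

lemma weights_of_point:
  fixes c :: "nat \<Rightarrow> real"
  assumes "p < q" and "q \<le> n" and "c p < c q" and "c p \<le> x" and "x \<le> c q"
  obtains w where "w \<in> simplex_weights n" and "\<And>j. w j \<noteq> 0 \<Longrightarrow> j \<in> {p..q}"
    and "(\<Sum>j=0..n. c j * w j) = x"
proof -
  define u where "u = (x - c p) / (c q - c p)"
  define w where "w = (\<lambda>j. (if j = p then 1 - u else 0) + (if j = q then u else 0))"
  have u: "0 \<le> u" "u \<le> 1" using assms by (auto simp: u_def field_simps)
  have "u * (c q - c p) = x - c p" using assms(3) by (simp add: u_def)
  then have mean: "c p * (1 - u) + c q * u = x" by (simp add: algebra_simps)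
  have "w \<in> simplex_weights n"
    using u assms(1,2) by (auto simp: simplex_weights_def w_def sum.distrib)
  moreover have "(\<Sum>j=0..n. c j * w j) = x"
  proof -
    have "c j * w j = (if j = p then c p * (1 - u) else 0) + (if j = q then c q * u else 0)" for j
      using assms(1) by (auto simp: w_def)
    then show ?thesis using mean assms(1,2) by (simp add: sum.distrib)
  qed
  moreover have "j \<in> {p..q}" if "w j \<noteq> 0" for j
    using that assms(1) by (auto simp: w_def split: if_splits)
  ultimately show thesis using that by blast
qed

text \<open>This is the face of \<open>Lam n\<close> whose vertices choose, for each
  \<open>i\<close>, one node of the cell \<open>t i\<close>.\<close>

definition cell_face :: "nat \<Rightarrow> ('d \<Rightarrow> nat \<Rightarrow> nat) \<Rightarrow> ('d \<Rightarrow> nat) \<Rightarrow> ('d \<Rightarrow> nat \<Rightarrow> real) set"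
  where "cell_face n \<tau> t =
    {lam \<in> Lam n. \<forall>i j. lam i j \<noteq> 0 \<longrightarrow> j \<in> {\<tau> i (t i - 1)..\<tau> i (t i)}}"

lemma convex_cell_face: "convex (cell_face n \<tau> t)"
proof (rule convexI)
  fix x y and u v :: real
  assume *: "x \<in> cell_face n \<tau> t" "y \<in> cell_face n \<tau> t" "0 \<le> u" "0 \<le> v" "u + v = 1"
  then have "u *\<^sub>R x + v *\<^sub>R y \<in> Lam n"
    by (intro convexD[OF convex_Lam]) (auto simp: cell_face_def)
  moreover have "x i j \<noteq> 0 \<or> y i j \<noteq> 0" if "(u *\<^sub>R x + v *\<^sub>R y) i j \<noteq> 0" for i j
    using that by auto
  ultimately show "u *\<^sub>R x + v *\<^sub>R y \<in> cell_face n \<tau> t"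
    using * unfolding cell_face_def by blast
qed

text \<open>Nonnegative entries cannot cancel, so the support of the combination contains that of
  \<open>x\<close>.\<close>

lemma cell_face_extremal:
  assumes "x \<in> Lam n" and "y \<in> Lam n" and "0 < u" and "0 \<le> v"
    and "u *\<^sub>R x + v *\<^sub>R y \<in> cell_face n \<tau> t"
  shows "x \<in> cell_face n \<tau> t"
proof -
  have "(u *\<^sub>R x + v *\<^sub>R y) i j \<noteq> 0" if "x i j \<noteq> 0" for i j
  proof -
    have "0 \<le> x i j" "0 \<le> y i j"
      using assms(1,2) by (auto simp: Lam_def simplex_weights_def)
    then have "0 < u * x i j" "0 \<le> v * y i j" using that assms(3,4) by auto
    then show ?thesis by simp
  qed
  then show ?thesis using assms(1,5) unfolding cell_face_def by blast
qed

text \<open>Identifies the hull over one cell in the original variables with the slice of the lifted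
  hull above the corresponding face. From left to right, the slice is convex because
  \<open>Amap\<close> is linear; from right to left, the face property keeps points off the face
  from contributing.\<close>

lemma hull_hyp_cell:
  fixes a :: "'d::finite \<Rightarrow> nat \<Rightarrow> real" and \<theta> :: "real ^ 'd \<Rightarrow> real ^ 'k::finite"
  shows "convex hull (hyp \<theta> (Amap n a ` cell_face n \<tau> t)) =
    {(Amap n a lam, \<mu>) | lam \<mu>.
      lam \<in> cell_face n \<tau> t \<and> (lam, \<mu>) \<in> convex hull (hyp (\<theta> \<circ> Amap n a) (Lam n))}"
    (is "?C = ?P")
proof
  let ?F = "cell_face n \<tau> t" and ?G = "convex hull (hyp (\<theta> \<circ> Amap n a) (Lam n))"
  show "?C \<subseteq> ?P"
  proof (rule hull_minimal)
    show "hyp \<theta> (Amap n a ` ?F) \<subseteq> ?P"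
    proof clarify
      fix f \<mu> assume "(f, \<mu>) \<in> hyp \<theta> (Amap n a ` ?F)"
      then obtain lam where "lam \<in> ?F" "f = Amap n a lam" "\<mu> \<le> \<theta> (Amap n a lam)"
        by (auto simp: hyp_def)
      moreover from this have "(lam, \<mu>) \<in> ?G"
        by (intro hull_inc) (auto simp: hyp_def cell_face_def)
      ultimately show "\<exists>lam \<mu>'. (f, \<mu>) = (Amap n a lam, \<mu>') \<and> lam \<in> ?F \<and> (lam, \<mu>') \<in> ?G"
        by blast
    qed
    show "convex ?P"
    proof (rule convexI)
      fix p q and u v :: real
      assume "p \<in> ?P" "q \<in> ?P" and uv: "0 \<le> u" "0 \<le> v" "u + v = 1"
      then obtain x \<mu> y \<nu> where pq: "p = (Amap n a x, \<mu>)" "q = (Amap n a y, \<nu>)"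
        and xy: "x \<in> ?F" "y \<in> ?F" "(x, \<mu>) \<in> ?G" "(y, \<nu>) \<in> ?G" by blast
      have "u *\<^sub>R x + v *\<^sub>R y \<in> ?F"
        using xy uv by (intro convexD[OF convex_cell_face]) auto
      moreover have "(u *\<^sub>R x + v *\<^sub>R y, u *\<^sub>R \<mu> + v *\<^sub>R \<nu>) \<in> ?G"
        using convexD[OF convex_convex_hull xy(3,4) uv] by simp
      moreover have "u *\<^sub>R p + v *\<^sub>R q = (Amap n a (u *\<^sub>R x + v *\<^sub>R y), u *\<^sub>R \<mu> + v *\<^sub>R \<nu>)"
        by (simp add: pq Amap_add Amap_scaleR)
      ultimately show "u *\<^sub>R p + v *\<^sub>R q \<in> ?P" by blast
    qed
  qed
  \<comment> \<open>Convex because \<open>?F\<close> is a face of \<open>\<Lambda>\<close>: a proper convex combination lies in \<open>?F\<close> only if both its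
    ends do.\<close>
  define Q where "Q = {(lam, \<mu>). lam \<in> Lam n \<and> (lam \<in> ?F \<longrightarrow> (Amap n a lam, \<mu>) \<in> ?C)}"
  have "?G \<subseteq> Q"
  proof (rule hull_minimal)
    show "hyp (\<theta> \<circ> Amap n a) (Lam n) \<subseteq> Q"
      by (auto simp: Q_def hyp_def intro!: hull_inc)
    show "convex Q"
      unfolding convex_alt
    proof clarify
      fix x \<mu> y \<nu> and u :: real
      assume x: "(x, \<mu>) \<in> Q" and y: "(y, \<nu>) \<in> Q" and u: "0 \<le> u" "u \<le> 1"
      have Lam: "x \<in> Lam n" "y \<in> Lam n" using x y by (auto simp: Q_def)
      show "(1 - u) *\<^sub>R (x, \<mu>) + u *\<^sub>R (y, \<nu>) \<in> Q"
      proof (cases "u = 0 \<or> u = 1")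
        case True
        then show ?thesis using x y by (auto simp del: scaleR_Pair)
      next
        case False
        let ?z = "(1 - u) *\<^sub>R x + u *\<^sub>R y"
        have "?z \<in> Lam n"
          using convexD[OF convex_Lam Lam, of "1 - u" u] u by simp
        moreover have "(Amap n a ?z, (1 - u) *\<^sub>R \<mu> + u *\<^sub>R \<nu>) \<in> ?C" if z: "?z \<in> ?F"
        proof -
          have "x \<in> ?F" "y \<in> ?F"
            using cell_face_extremal[OF Lam, of "1 - u" u] cell_face_extremal[OF Lam(2,1), of u "1 - u"]
              z False u by (auto simp: add.commute)
          then have "(Amap n a x, \<mu>) \<in> ?C" "(Amap n a y, \<nu>) \<in> ?C" using x y by (auto simp: Q_def)
          from convexD[OF convex_convex_hull this, of "1 - u" u] u show ?thesis
            by (simp add: Amap_add Amap_scaleR)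
        qed
        ultimately show ?thesis by (simp add: Q_def)
      qed
    qed
  qed
  then show "?P \<subseteq> ?C" by (auto simp: Q_def)
qed

context
  fixes n :: nat and a :: "'d::finite \<Rightarrow> nat \<Rightarrow> real" and l :: "'d \<Rightarrow> nat"
    and \<tau> :: "'d \<Rightarrow> nat \<Rightarrow> nat" and t :: "'d \<Rightarrow> nat"
  assumes a: "\<And>i. strict_mono_on {0..n} (a i)"
    and \<tau>l: "\<And>i. \<tau> i (l i) = n"
    and \<tau>: "\<And>i. strict_mono_on {0..l i} (\<tau> i)"
    and t: "\<And>i. t i \<in> {1..l i}"
begin

lemma cell_le: "\<tau> i (t i) \<le> n"
  using t[of i] \<tau>l[of i] strict_mono_on_leD[OF \<tau>, of "t i" i "l i"] by auto

lemma cell_less: "\<tau> i (t i - 1) < \<tau> i (t i)"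
  using t[of i] by (intro strict_mono_onD[OF \<tau>]) auto

text \<open>The coordinates are independent: a weighted mean stays between the extreme nodes of its
  cell, and each point of a side is interpolated from the two end nodes.\<close>

lemma Amap_cell_face:
  "Amap n a ` cell_face n \<tau> t =
    cbox (\<chi> i. a i (\<tau> i (t i - 1))) (\<chi> i. a i (\<tau> i (t i)))" (is "_ = ?H")
proof
  show "Amap n a ` cell_face n \<tau> t \<subseteq> ?H"
  proof clarify
    fix lam assume lam: "lam \<in> cell_face n \<tau> t"
    have "a i (\<tau> i (t i - 1)) \<le> (\<Sum>j=0..n. a i j * lam i j) \<and>
        (\<Sum>j=0..n. a i j * lam i j) \<le> a i (\<tau> i (t i))" for i
    proof -
      have w: "lam i \<in> simplex_weights n" using lam by (simp add: cell_face_def Lam_def)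
      have "a i (\<tau> i (t i - 1)) \<le> a i j \<and> a i j \<le> a i (\<tau> i (t i))" if "lam i j \<noteq> 0" for j
      proof -
        have "j \<in> {\<tau> i (t i - 1)..\<tau> i (t i)}" using lam that unfolding cell_face_def by blast
        then show ?thesis
          using cell_le[of i] by (auto intro!: strict_mono_on_leD[OF a])
      qed
      then show ?thesis using weighted_mean_bounds[OF w] by blast
    qed
    then show "Amap n a lam \<in> ?H" by (simp add: mem_box_cart Amap_def)
  qed
  show "?H \<subseteq> Amap n a ` cell_face n \<tau> t"
  proof
    fix x assume x: "x \<in> ?H"
    have "\<exists>w. w \<in> simplex_weights n \<and> (\<forall>j. w j \<noteq> 0 \<longrightarrow> j \<in> {\<tau> i (t i - 1)..\<tau> i (t i)}) \<and>
        (\<Sum>j=0..n. a i j * w j) = x $ i" for i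
    proof -
      have "a i (\<tau> i (t i - 1)) < a i (\<tau> i (t i))"
        using cell_le[of i] cell_less[of i] by (intro strict_mono_onD[OF a]) auto
      moreover have "a i (\<tau> i (t i - 1)) \<le> x $ i" "x $ i \<le> a i (\<tau> i (t i))"
        using x by (auto simp: mem_box_cart)
      ultimately show ?thesis
        using weights_of_point[OF cell_less cell_le, of "a i" i "x $ i"] by metis
    qed
    then obtain lam where "\<And>i. lam i \<in> simplex_weights n"
      "\<And>i j. lam i j \<noteq> 0 \<Longrightarrow> j \<in> {\<tau> i (t i - 1)..\<tau> i (t i)}"
      "\<And>i. (\<Sum>j=0..n. a i j * lam i j) = x $ i" by metis
    then have "lam \<in> cell_face n \<tau> t" "x = Amap n a lam"
      by (auto simp: cell_face_def Lam_def Amap_def vec_eq_iff)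
    then show "x \<in> Amap n a ` cell_face n \<tau> t" by blast
  qed
qed

end

section \<open>Extreme points of the relaxation\<close>

text \<open>As the weights sum to 1, the upper bound is a partial sum too. Both bounds are then
  linear in \<open>w\<close> and lie in [0,1], which yields the cube constraint.\<close>

lemma LOG_relaxed_iff:
  assumes "w \<in> simplex_weights n"
  shows "(w, v) \<in> LOG_relaxed n K \<zeta> \<longleftrightarrow> (\<forall>k. k \<notin> {1..K} \<longrightarrow> v k = 0) \<and>
    (\<forall>k\<in>{1..K}. v k \<in> {sum w ({0..n} - Lset n \<zeta> k)..sum w (Rset n \<zeta> k)})"
proof -
  have "1 - (\<Sum>j\<in>{0..n} - Rset n \<zeta> k. w j) = sum w (Rset n \<zeta> k)" for k
    by (rule simplex_weights_sum_complement[OF assms]) (auto simp: Rset_def)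
  moreover have "0 \<le> v k \<and> v k \<le> 1"
    if "v k \<in> {sum w ({0..n} - Lset n \<zeta> k)..sum w (Rset n \<zeta> k)}" for k
  proof -
    have "Rset n \<zeta> k \<subseteq> {0..n}" by (auto simp: Rset_def)
    then show ?thesis
      using that simplex_weights_sum_bounds(1)[OF assms, of "{0..n} - Lset n \<zeta> k"]
        simplex_weights_sum_bounds(2)[OF assms, of "Rset n \<zeta> k"] by auto
  qed
  ultimately show ?thesis
    using assms by (auto simp: LOG_relaxed_def unit_cube_def)
qed

text \<open>Stated for a generating set \<open>V\<close> above the vertices, because extreme points
  of \<open>convex hull V\<close> belong to \<open>V\<close>.\<close>

lemma extreme_relaxation_binary:
  fixes n :: nat and a :: "'d::finite \<Rightarrow> nat \<Rightarrow> real" and K :: "'d \<Rightarrow> nat"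
    and \<zeta> :: "'d \<Rightarrow> nat \<Rightarrow> nat \<Rightarrow> real" and V :: "(('d \<Rightarrow> nat \<Rightarrow> real) \<times> (real ^ 'k::finite)) set"
  assumes \<zeta>: "\<And>i j k. k \<in> {1..K i} \<Longrightarrow> \<zeta> i j k \<in> {0, 1}"
    and V: "V \<subseteq> vert (Lam n) \<times> UNIV"
    and p: "((f, \<mu>), lam, \<delta>) extreme_point_of
      {((f, \<mu>), lam, \<delta>). (lam, \<mu>) \<in> convex hull V \<and> f = Amap n a lam \<and>
        (\<forall>i. (lam i, \<delta> i) \<in> LOG_relaxed n (K i) (\<zeta> i))}" (is "_ extreme_point_of ?R")
  shows "\<delta> i \<in> binary_vectors (K i)"
proof -
  have V_Lam: "fst x \<in> Lam n" if "x \<in> convex hull V" for x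
  proof -
    have "convex hull V \<subseteq> Lam n \<times> UNIV"
      using V by (intro hull_minimal convex_Times convex_Lam convex_UNIV)
        (auto simp: vert_def extreme_point_of_def)
    then show ?thesis using that by auto
  qed
  have pR: "((f, \<mu>), lam, \<delta>) \<in> ?R" using p by (simp add: extreme_point_of_def)
  have not_between: "((f, \<mu>), lam, \<delta>) \<notin> open_segment x y" if "x \<in> ?R" "y \<in> ?R" for x y
    using p that unfolding extreme_point_of_def by blast
  have hull: "(lam, \<mu>) \<in> convex hull V" and f: "f = Amap n a lam"
    and LOG: "\<And>i. (lam i, \<delta> i) \<in> LOG_relaxed n (K i) (\<zeta> i)" using pR by auto
  have w: "lam i \<in> simplex_weights n" for i using V_Lam[OF hull] by (simp add: Lam_def)
  define lo where "lo = (\<lambda>i k. {0..n} - Lset n (\<zeta> i) k)"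
  define up where "up = (\<lambda>i k. Rset n (\<zeta> i) k)"
  \<comment> \<open>A node outside \<open>Lset\<close> touches only words with entry 0 at
    \<open>k\<close>, hence lies in \<open>Rset\<close>; so the lower bound never exceeds the upper
    one on \<open>Lam n\<close>.\<close>
  have lo_up: "lo i k \<subseteq> up i k" if "k \<in> {1..K i}" for i k
    using \<zeta>[OF that] by (fastforce simp: lo_def up_def Lset_def Rset_def)
  have up_le: "up i k \<subseteq> {0..n}" for i k by (auto simp: up_def Rset_def)
  have relaxed: "(w, v) \<in> LOG_relaxed n (K i) (\<zeta> i) \<longleftrightarrow> (\<forall>k. k \<notin> {1..K i} \<longrightarrow> v k = 0) \<and>
      (\<forall>k\<in>{1..K i}. v k \<in> {sum w (lo i k)..sum w (up i k)})"
    if "w \<in> simplex_weights n" for w v i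
    using LOG_relaxed_iff[OF that] by (simp add: lo_def up_def)
  \<comment> \<open>For fixed \<open>lam\<close>, each \<open>\<delta> i k\<close> ranges over its
    own interval independently of all else. A value strictly inside could be moved to both ends,
    contradicting extremality; \<open>s\<close> is its relative position.\<close>
  have tight: "\<delta> i k = sum (lam i) (lo i k) \<or> \<delta> i k = sum (lam i) (up i k)"
    if k: "k \<in> {1..K i}" for i k
  proof (rule ccontr)
    let ?l = "sum (lam i) (lo i k)" and ?u = "sum (lam i) (up i k)"
    let ?p = "\<lambda>c. ((f, \<mu>), lam, \<delta>(i := (\<delta> i)(k := c)))"
    assume "\<not> ?thesis"
    moreover have "\<delta> i k \<in> {?l..?u}" using LOG[of i] relaxed[OF w] k by blast
    ultimately have lu: "?l < \<delta> i k" "\<delta> i k < ?u" by auto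
    have R: "?p c \<in> ?R" if "c \<in> {?l..?u}" for c
      using hull f LOG that k by (auto simp: relaxed[OF w])
    have ends: "?p ?l \<in> ?R" "?p ?u \<in> ?R" by (rule R; use lu in simp)+
    define s where "s = (\<delta> i k - ?l) / (?u - ?l)"
    have s: "0 < s" "s < 1" "s * (?u - ?l) = \<delta> i k - ?l"
      using lu by (auto simp: s_def field_simps)
    have "\<delta> = (1 - s) *\<^sub>R \<delta>(i := (\<delta> i)(k := ?l)) + s *\<^sub>R \<delta>(i := (\<delta> i)(k := ?u))"
      using s(3) by (auto simp: fun_eq_iff algebra_simps)
    then have "((f, \<mu>), lam, \<delta>) = (1 - s) *\<^sub>R ?p ?l + s *\<^sub>R ?p ?u"
      by (simp add: algebra_simps)
    moreover have "?p ?l \<noteq> ?p ?u"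
    proof
      assume "?p ?l = ?p ?u"
      then have "(\<delta>(i := (\<delta> i)(k := ?l))) i k = (\<delta>(i := (\<delta> i)(k := ?u))) i k" by (metis Pair_inject)
      then show False using lu by simp
    qed
    ultimately have "((f, \<mu>), lam, \<delta>) \<in> open_segment (?p ?l) (?p ?u)"
      using s(1,2) unfolding in_segment by blast
    then show False using not_between[OF ends] by contradiction
  qed
  \<comment> \<open>\<open>S\<close> records which bound is attained at the given
    \<open>lam\<close>. Freezing this choice for all \<open>x\<close> makes \<open>D\<close> linear,
    and \<open>lo i k \<subseteq> S i k \<subseteq> up i k\<close> makes it feasible on all of
    \<open>Lam n\<close>.\<close>
  define S where "S = (\<lambda>i k. if \<delta> i k = sum (lam i) (lo i k) then lo i k else up i k)"
  define D where "D = (\<lambda>x i k. if k \<in> {1..K i} then sum (x i) (S i k) else (0::real))"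
  have S: "lo i k \<subseteq> S i k \<and> S i k \<subseteq> up i k" if "k \<in> {1..K i}" for i k
    using lo_up[OF that] by (auto simp: S_def)
  have D_relaxed: "(x i, D x i) \<in> LOG_relaxed n (K i) (\<zeta> i)" if "x \<in> Lam n" for x i
  proof -
    have x: "x i \<in> simplex_weights n" using that by (simp add: Lam_def)
    have "D x i k \<in> {sum (x i) (lo i k)..sum (x i) (up i k)}" if "k \<in> {1..K i}" for k
      using simplex_weights_sum_le[OF x] S[OF that] up_le[of i k] that by (auto simp: D_def)
    then show ?thesis by (subst relaxed[OF x]) (auto simp: D_def)
  qed
  have D_linear: "D (u *\<^sub>R x + v *\<^sub>R y) = u *\<^sub>R D x + v *\<^sub>R D y" for u v x y
    by (auto simp: D_def fun_eq_iff sum.distrib sum_distrib_left)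
  have \<delta>: "\<delta> = D lam"
  proof (intro ext)
    fix i k show "\<delta> i k = D lam i k"
      using tight[of k i] LOG[of i] relaxed[OF w] by (auto simp: D_def S_def)
  qed
  \<comment> \<open>An injective linear lift of the hull into the relaxation that hits the given
    extreme point at \<open>(lam, \<mu>)\<close>. A segment of the hull around
    \<open>(lam, \<mu>)\<close> would be carried to a forbidden segment of the relaxation.\<close>
  define \<Phi> where "\<Phi> = (\<lambda>(x, \<nu>). ((Amap n a x, \<nu> :: real ^ 'k), x, D x))"
  have \<Phi>_linear: "\<Phi> (u *\<^sub>R x + v *\<^sub>R y) = u *\<^sub>R \<Phi> x + v *\<^sub>R \<Phi> y" for u v x y
    by (simp add: \<Phi>_def split_beta Amap_add Amap_scaleR D_linear)
  have \<Phi>_R: "\<Phi> x \<in> ?R" if "x \<in> convex hull V" for x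
    using that D_relaxed V_Lam[OF that] by (auto simp: \<Phi>_def split_beta)
  have \<Phi>_p: "\<Phi> (lam, \<mu>) = ((f, \<mu>), lam, \<delta>)" by (simp add: \<Phi>_def f \<delta>)
  have "(lam, \<mu>) extreme_point_of convex hull V"
    unfolding extreme_point_of_def
  proof (intro conjI ballI notI hull)
    fix x y assume xy: "x \<in> convex hull V" "y \<in> convex hull V" "(lam, \<mu>) \<in> open_segment x y"
    then obtain u where u: "x \<noteq> y" "0 < u" "u < 1" "(lam, \<mu>) = (1 - u) *\<^sub>R x + u *\<^sub>R y"
      by (auto simp only: in_segment)
    have "\<Phi> x \<noteq> \<Phi> y" using u(1) by (auto simp: \<Phi>_def split_beta prod_eq_iff)
    moreover have "((f, \<mu>), lam, \<delta>) = (1 - u) *\<^sub>R \<Phi> x + u *\<^sub>R \<Phi> y"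
      using \<Phi>_p u(4) \<Phi>_linear by metis
    ultimately have "((f, \<mu>), lam, \<delta>) \<in> open_segment (\<Phi> x) (\<Phi> y)"
      using u(2,3) unfolding in_segment by blast
    then show False using not_between[OF \<Phi>_R \<Phi>_R] xy(1,2) by blast
  qed
  then have "(lam, \<mu>) \<in> V" by (rule extreme_point_of_convex_hull)
  then have "lam \<in> vert (Lam n)" using V by auto
  then have "lam i j \<in> {0, 1}" for i j by (rule vert_Lam_binary)
  then have "sum (lam i) (S i k) \<in> {0, 1}" if "k \<in> {1..K i}" for i k
    using S[OF that] up_le[of i k] by (intro simplex_weights_binary_sum[OF w]) auto
  then show ?thesis by (auto simp: \<delta> D_def binary_vectors_def)
qed

section \<open>The projection of the formulation and its ideality\<close>

theorem proposition3p4: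
  fixes n :: nat
    and fL fU :: "real ^ 'd"
    and a :: "'d::finite \<Rightarrow> nat \<Rightarrow> real"
    and l :: "'d \<Rightarrow> nat"
    and \<tau> :: "'d \<Rightarrow> nat \<Rightarrow> nat"
    and \<eta> :: "'d \<Rightarrow> nat \<Rightarrow> nat \<Rightarrow> real"
    and \<theta> :: "(real ^ 'd) \<Rightarrow> (real ^ 'k::finite)"
  assumes "1 \<le> n"
    and "\<And>i. a i 0 = fL $ i" and "\<And>i. a i n = fU $ i"
    and "\<And>i. strict_mono_on {0..n} (a i)"
    and "\<And>i. \<tau> i 0 = 0" and "\<And>i. \<tau> i (l i) = n"
    and "\<And>i. strict_mono_on {0..l i} (\<tau> i)"
    and "\<And>i. gray_code (l i) (\<eta> i)"
    and "convex hull (hyp (\<theta> \<circ> Amap n a) (Lam n)) =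
         convex hull (hyp (\<theta> \<circ> Amap n a) (vert (Lam n)))"
  shows "ideal_MIP_formulation (\<lambda>i. ceil_log2 (l i))
    {((f, \<mu>), lam, \<delta>). (lam, \<mu>) \<in> convex hull (hyp (\<theta> \<circ> Amap n a) (Lam n)) \<and>
       f = Amap n a lam \<and>
       (\<forall>i. (lam i, \<delta> i) \<in> LOG_relaxed n (ceil_log2 (l i)) (interval_code n (\<tau> i) (\<eta> i)))}
    {((f, \<mu>), lam, \<delta>). (lam, \<mu>) \<in> convex hull (hyp (\<theta> \<circ> Amap n a) (Lam n)) \<and>
       f = Amap n a lam \<and>
       (\<forall>i. (lam i, \<delta> i) \<in> LOG n (ceil_log2 (l i)) (interval_code n (\<tau> i) (\<eta> i)))}
    (\<Union>H \<in> grid_boxes a l \<tau>. convex hull (hyp \<theta> H))"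
proof -
  let ?G = "convex hull (hyp (\<theta> \<circ> Amap n a) (Lam n))"
  let ?\<zeta> = "\<lambda>i. interval_code n (\<tau> i) (\<eta> i)" and ?K = "\<lambda>i. ceil_log2 (l i)"
  let ?R = "{((f, \<mu>), lam, \<delta>). (lam, \<mu>) \<in> ?G \<and> f = Amap n a lam \<and>
       (\<forall>i. (lam i, \<delta> i) \<in> LOG_relaxed n (?K i) (?\<zeta> i))}"
  let ?E = "{((f, \<mu>), lam, \<delta>). (lam, \<mu>) \<in> ?G \<and> f = Amap n a lam \<and>
       (\<forall>i. (lam i, \<delta> i) \<in> LOG n (?K i) (?\<zeta> i))}"
  let ?T = "{t. \<forall>i. t i \<in> {1..l i}}"
  have "binary_vectors K \<subseteq> unit_cube K" for K
    by (fastforce simp: binary_vectors_def unit_cube_def)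
  then have LOG: "(w, v) \<in> LOG n K \<zeta> \<longleftrightarrow> (w, v) \<in> LOG_relaxed n K \<zeta> \<and> v \<in> binary_vectors K"
    for w v K \<zeta> by (auto simp: LOG_def LOG_relaxed_def)
  have integer: "?E = ?R \<inter> (UNIV \<times> UNIV \<times> {\<delta>. \<forall>i. \<delta> i \<in> binary_vectors (?K i)})"
    by (auto simp: LOG)

  \<comment> \<open>The constraints on \<open>\<delta>\<close> decouple over \<open>i\<close>, so a
    suitable \<open>\<delta>\<close> exists as soon as each row has its own binary vector.\<close>
  have "(\<lambda>(x, y, \<delta>). x) ` ?E =
      {(Amap n a lam, \<mu>) | lam \<mu>. (lam, \<mu>) \<in> ?G \<and> (\<forall>i. \<exists>v. (lam i, v) \<in> LOG n (?K i) (?\<zeta> i))}"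
    by (auto simp: image_iff) metis
  also have "\<dots> = {(Amap n a lam, \<mu>) | lam \<mu>. (lam, \<mu>) \<in> ?G \<and> (\<exists>t\<in>?T. lam \<in> cell_face n \<tau> t)}"
  proof -
    have "(\<forall>i. \<exists>v. (lam i, v) \<in> LOG n (?K i) (?\<zeta> i)) \<longleftrightarrow> (\<exists>t\<in>?T. lam \<in> cell_face n \<tau> t)" for lam
    proof
      assume *: "\<forall>i. \<exists>v. (lam i, v) \<in> LOG n (?K i) (?\<zeta> i)"
      then have "\<exists>t. t \<in> {1..l i} \<and> (\<forall>j. lam i j \<noteq> 0 \<longrightarrow> j \<in> {\<tau> i (t - 1)..\<tau> i t})" for i
        using LOG_imp_cell[OF assms(1,5,6,7,8)] by metis
      then obtain t where "\<And>i. t i \<in> {1..l i}"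
        "\<And>i j. lam i j \<noteq> 0 \<Longrightarrow> j \<in> {\<tau> i (t i - 1)..\<tau> i (t i)}" by metis
      moreover have "lam \<in> Lam n" using * by (auto simp: Lam_def LOG_def)
      ultimately show "\<exists>t\<in>?T. lam \<in> cell_face n \<tau> t" by (auto simp: cell_face_def)
    next
      assume "\<exists>t\<in>?T. lam \<in> cell_face n \<tau> t"
      then obtain t where t: "\<And>i. t i \<in> {1..l i}" "lam \<in> Lam n"
        "\<And>i j. lam i j \<noteq> 0 \<Longrightarrow> j \<in> {\<tau> i (t i - 1)..\<tau> i (t i)}"
        unfolding cell_face_def by blast
      then have "lam i \<in> simplex_weights n" for i by (simp add: Lam_def)
      with t show "\<forall>i. \<exists>v. (lam i, v) \<in> LOG n (?K i) (?\<zeta> i)"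
        using cell_imp_LOG[OF assms(6,7,8)] by blast
    qed
    then show ?thesis by simp
  qed
  also have "\<dots> = (\<Union>t\<in>?T. {(Amap n a lam, \<mu>) | lam \<mu>. lam \<in> cell_face n \<tau> t \<and> (lam, \<mu>) \<in> ?G})"
    by blast
  also have "\<dots> = (\<Union>t\<in>?T. convex hull (hyp \<theta> (Amap n a ` cell_face n \<tau> t)))"
    by (intro SUP_cong refl, rule hull_hyp_cell[symmetric])
  also have "\<dots> = (\<Union>t\<in>?T. convex hull (hyp \<theta>
      (cbox (\<chi> i. a i (\<tau> i (t i - 1))) (\<chi> i. a i (\<tau> i (t i))))))"
    using Amap_cell_face[of n a \<tau> l, OF assms(4,6,7)] by (intro SUP_cong refl) simp
  also have "\<dots> = (\<Union>H \<in> grid_boxes a l \<tau>. convex hull (hyp \<theta> H))"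
    unfolding grid_boxes_def by blast
  finally have proj: "(\<Union>H \<in> grid_boxes a l \<tau>. convex hull (hyp \<theta> H)) = (\<lambda>(x, y, \<delta>). x) ` ?E" ..

  have \<zeta>: "?\<zeta> i j k \<in> {0, 1}" if "k \<in> {1..?K i}" for i j k
    using interval_code_binary[OF assms(1,5,6,7,8), of i j] that by (auto simp: binary_vectors_def)
  \<comment> \<open>The hypothesis on \<open>\<theta>\<close> enters here: it presents the lifted
    hull as generated by points above vertices of \<open>Lam n\<close>, as the lemma on extreme
    points requires.\<close>
  have "hyp (\<theta> \<circ> Amap n a) (vert (Lam n)) \<subseteq> vert (Lam n) \<times> UNIV"
    by (auto simp: hyp_def)
  note extreme = extreme_relaxation_binary[OF \<zeta> this, folded assms(9)]
  have "(\<lambda>(x, y, \<delta>). \<delta>) ` vert ?R \<subseteq> {\<delta>. \<forall>i. \<delta> i \<in> binary_vectors (?K i)}"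
    using extreme by (auto simp: vert_def)
  with integer proj show ?thesis
    unfolding ideal_MIP_formulation_def by blast
qed

end
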